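(* Let $d\ge 0$ be an integer and let $G$ be a $d$-regular graph that contains no $4$-cycle. If $G$ is not super-edge-connected, then $\varphi(G)=d+1$.
   Context: All graphs are finite, simple (undirected, loopless, without multiple edges) and have at least one vertex; they are not assumed connected. "Contains no $4$-cycle" means that $G$ has no subgraph (induced or not) isomorphic to the cycle $C_4$. A (proper vertex) coloring of $G$ is a function $f:V(G)\to C$ into a set $C$ of colors such that $f(u)\ne f(v)$ for every edge $\{u,v\}$. A b-coloring is a coloring $f:V(G)\to C$ such that for each $c\in C$ there is a vertex $v$ with $f(v)=c$ and $f(N_G(v))=C\setminus\{c\}$, where $N_G(v)$ is the set of neighbors of $v$. The b-chromatic number $\varphi(G)$ is the maximum cardinality of a set $C$ for which a b-coloring $f:V(G)\to C$ exists. The edge connectivity $\lambda(G)$ is the minimum cardinality of a subset $U$ of $E(G)$ such that $G\setminus U$ (the graph obtained by deleting the edges in $U$) is either disconnected or a graph with only one vertex. An edge-cut of $G$ is a subset of $E(G)$ whose deletion from $G$ yields a disconnected graph (so $\varnothing$ is an edge-cut if $G$ is disconnected). A minimum edge-cut is an edge-cut of cardinality $\lambda(G)$. A $d$-regular graph $G$ is called super-edge-connected if $\lambda(G)=d$ and every minimum edge-cut of $G$ is the set of all edges incident with some vertex of $G$. *)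

theory Defs
  imports Main
begin

locale simple_graph =
  fixes V :: "'a set" and E :: "'a set set"
  assumes finite_vertices: "finite V"
    and vertices_nonempty: "V \<noteq> {}"
    and edges: "\<And>e. e \<in> E \<Longrightarrow> e \<subseteq> V \<and> card e = 2"

definition neighbors :: "'a set set \<Rightarrow> 'a \<Rightarrow> 'a set" where
  "neighbors E v = {u. {u, v} \<in> E}"

definition incident_edges :: "'a set set \<Rightarrow> 'a \<Rightarrow> 'a set set" where
  "incident_edges E v = {e \<in> E. v \<in> e}"

definition regular :: "'a set \<Rightarrow> 'a set set \<Rightarrow> nat \<Rightarrow> bool" where
  "regular V E d \<longleftrightarrow> (\<forall>v\<in>V. card (neighbors E v) = d)"

definition contains_C4 :: "'a set set \<Rightarrow> bool" where
  "contains_C4 E \<longleftrightarrow>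
     (\<exists>a b c d. distinct [a, b, c, d] \<and>
        {a, b} \<in> E \<and> {b, c} \<in> E \<and> {c, d} \<in> E \<and> {d, a} \<in> E)"

definition coloring :: "'a set \<Rightarrow> 'a set set \<Rightarrow> ('a \<Rightarrow> 'c) \<Rightarrow> 'c set \<Rightarrow> bool" where
  "coloring V E f C \<longleftrightarrow>
     f ` V \<subseteq> C \<and> (\<forall>u v. {u, v} \<in> E \<longrightarrow> f u \<noteq> f v)"

definition b_coloring :: "'a set \<Rightarrow> 'a set set \<Rightarrow> ('a \<Rightarrow> 'c) \<Rightarrow> 'c set \<Rightarrow> bool" where
  "b_coloring V E f C \<longleftrightarrow>
     coloring V E f C \<and>
     (\<forall>c\<in>C. \<exists>v\<in>V. f v = c \<and> f ` neighbors E v = C - {c})"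

text \<open>
  In a b-coloring every color is used, so on a finite graph the color set is
  finite; hence taking colors in \<^typ>\<open>nat\<close> loses no generality, and the maximum
  below ranges over a finite set (see \<open>finite_b_coloring_cards\<close>).
\<close>

definition b_chromatic_number :: "'a set \<Rightarrow> 'a set set \<Rightarrow> nat" where
  "b_chromatic_number V E =
     Max {card C | C. \<exists>f :: 'a \<Rightarrow> nat. b_coloring V E f C}"

lemma b_coloring_image_eq: "b_coloring V E f C \<Longrightarrow> f ` V = C"
  unfolding b_coloring_def coloring_def by fastforce

lemma finite_b_coloring_cards:
  assumes "finite V"
  shows "finite {card C | C. \<exists>f :: 'a \<Rightarrow> nat. b_coloring V E f C}"
proof (rule finite_subset)
  show "{card C | C. \<exists>f :: 'a \<Rightarrow> nat. b_coloring V E f C} \<subseteq> {..card V}"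
    using card_image_le[OF assms] by (auto dest!: b_coloring_image_eq)
qed simp

definition connected_graph :: "'a set \<Rightarrow> 'a set set \<Rightarrow> bool" where
  "connected_graph V E \<longleftrightarrow> (\<forall>u\<in>V. \<forall>v\<in>V. (\<lambda>x y. {x, y} \<in> E)\<^sup>*\<^sup>* u v)"

definition edge_cut :: "'a set \<Rightarrow> 'a set set \<Rightarrow> 'a set set \<Rightarrow> bool" where
  "edge_cut V E U \<longleftrightarrow> U \<subseteq> E \<and> \<not> connected_graph V (E - U)"

definition edge_connectivity :: "'a set \<Rightarrow> 'a set set \<Rightarrow> nat" where
  "edge_connectivity V E =
     Min {card U | U. U \<subseteq> E \<and> (\<not> connected_graph V (E - U) \<or> card V = 1)}"

definition minimum_edge_cut :: "'a set \<Rightarrow> 'a set set \<Rightarrow> 'a set set \<Rightarrow> bool" where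
  "minimum_edge_cut V E U \<longleftrightarrow> edge_cut V E U \<and> card U = edge_connectivity V E"

definition super_edge_connected :: "'a set \<Rightarrow> 'a set set \<Rightarrow> nat \<Rightarrow> bool" where
  "super_edge_connected V E d \<longleftrightarrow>
     regular V E d \<and> edge_connectivity V E = d \<and>
     (\<forall>U. minimum_edge_cut V E U \<longrightarrow> (\<exists>v\<in>V. U = incident_edges E v))"

end

theory Submission
  imports Defs
begin

text \<open>
  A partial proper coloring with \<open>d + 1\<close> colors extends greedily, so it suffices to color the closed
  neighborhoods of \<open>d + 1\<close> vertices of different colors such that each of them sees all colors.

  A graph that is not super-edge-connected has a partition \<open>X\<close>, \<open>Y\<close> of its vertices into parts of
  size at least two with at most \<open>d\<close> edges across. Call a vertex interior if all its neighbors are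
  on its own side. If \<open>d \<ge> 4\<close>, or \<open>d = 3\<close> and there is no triangle, counting cut edges gives two
  interior vertices on each side; they have at most one common neighbor, so one of them, \<open>x\<close>, has at
  least \<open>d div 2\<close> interior neighbors. Prescribe any bijective coloring of the closed
  neighborhood of \<open>x\<close>. Since distinct vertices have at most one common neighbor, it extends so that
  up to \<open>d div 2\<close> chosen interior neighbors of \<open>x\<close> see all colors as well: each newly colored
  neighborhood has few conflicts with the earlier ones. Doing this on both sides yields \<open>d + 1\<close>
  candidates, those in \<open>X\<close> with a color set \<open>A\<close> and those in \<open>Y\<close> with the complement \<open>B\<close>.

  Conflicts between the two sides only occur along cut edges. The chosen neighbors can be
  selected so that fewer than \<open>card A\<close> cut edges can carry a conflict between colors in \<open>A\<close>, and
  fewer than \<open>card B\<close> one between colors in \<open>B\<close>. Hence some cyclic shift of \<open>A\<close> and some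
  cyclic shift of \<open>B\<close> on the \<open>Y\<close>-side remove all conflicts. For \<open>d \<le> 2\<close>, and for \<open>d = 3\<close> with a
  triangle, explicit colorings of at most eight vertices suffice.
\<close>

section \<open>Bijections avoiding conflicts\<close>

text \<open>Both conflict bounds in the coloring extension come from this count: every earlier
  neighbor of the center is responsible for at most one conflicting value.\<close>

lemma card_Collect_functional_le:
  assumes "finite T" and "\<And>y z z'. y \<in> T \<Longrightarrow> Q y z \<Longrightarrow> Q y z' \<Longrightarrow> z = z'"
  shows "card {z. \<exists>y\<in>T. Q y z} \<le> card T"
proof (rule surj_card_le[OF assms(1)])
  show "{z. \<exists>y\<in>T. Q y z} \<subseteq> (\<lambda>y. THE z. Q y z) ` T"
  proof
    fix z assume "z \<in> {z. \<exists>y\<in>T. Q y z}"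
    then obtain y where y: "y \<in> T" "Q y z" by blast
    then have "(THE z. Q y z) = z" using assms(2) by blast
    with y show "z \<in> (\<lambda>y. THE z. Q y z) ` T" by force
  qed
qed

text \<open>A weak form of Hall's theorem: as long as a bijection has a conflict at some \<open>w\<close>, at most
  \<open>2 * t - 1\<close> elements are unsuitable for exchanging values with \<open>w\<close>, and a suitable
  exchange lowers the number of conflicts.\<close>

lemma bij_betw_avoiding_aux:
  assumes "finite S" "bij_betw h S D" "2 * t \<le> card S"
    and "\<And>w. w \<in> S \<Longrightarrow> card {c\<in>D. F w c} \<le> t"
    and "\<And>c. c \<in> D \<Longrightarrow> card {w\<in>S. F w c} \<le> t"
  shows "\<exists>h'. bij_betw h' S D \<and> (\<forall>w\<in>S. \<not> F w (h' w))"
  using assms(2)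
proof (induction "card {w\<in>S. F w (h w)}" arbitrary: h rule: less_induct)
  case less
  show ?case
  proof (cases "\<exists>w\<in>S. F w (h w)")
    case False
    then show ?thesis using less.prems by blast
  next
    case True
    then obtain w where w: "w \<in> S" "F w (h w)" by blast
    have inj: "inj_on h S" and im: "h ` S = D" using less.prems by (auto simp: bij_betw_def)
    let ?P = "{u\<in>S. F u (h w)}" and ?Q = "{u\<in>S. F w (h u)}"
    have "card ?P \<le> t" using assms(5) w im by blast
    moreover have "card ?Q \<le> t"
    proof -
      have "card ?Q = card (h ` ?Q)"
        by (rule card_image[symmetric]) (rule inj_on_subset[OF inj], auto)
      also have "h ` ?Q = {c\<in>D. F w c}" using im by auto
      finally show ?thesis using assms(4) w by simp
    qed
    moreover have "card (?P \<union> ?Q) + card (?P \<inter> ?Q) = card ?P + card ?Q"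
      using card_Un_Int[of ?P ?Q] assms(1) by simp
    \<comment> \<open>\<open>w\<close> lies in both sets. This overlap gives the strict inequality
      even when \<open>card S = 2 * t\<close>.\<close>
    moreover have "card (?P \<inter> ?Q) > 0"
      using w assms(1) by (auto simp: card_gt_0_iff)
    ultimately have less: "card (?P \<union> ?Q) < card S" using assms(3) by linarith
    have fin: "finite (?P \<union> ?Q)" using assms(1) by simp
    have "\<not> S \<subseteq> ?P \<union> ?Q"
    proof
      assume "S \<subseteq> ?P \<union> ?Q"
      from card_mono[OF fin this] less show False by linarith
    qed
    then obtain u where u: "u \<in> S" "u \<notin> ?P \<union> ?Q" by blast
    have ne: "u \<noteq> w" using u w by auto
    let ?h = "\<lambda>v. if v = u then h w else if v = w then h u else h v"
    have "inj_on ?h S" using inj u(1) w(1) by (auto simp: inj_on_def split: if_splits)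
    moreover have "?h ` S = D"
    proof
      show "?h ` S \<subseteq> D" using im u w by auto
      show "D \<subseteq> ?h ` S"
      proof
        fix c assume "c \<in> D"
        then obtain v where v: "v \<in> S" "c = h v" using im by blast
        show "c \<in> ?h ` S"
          by (rule image_eqI[of _ _ "if v = u then w else if v = w then u else v"]) (use v u w in auto)
      qed
    qed
    ultimately have bij: "bij_betw ?h S D" by (simp add: bij_betw_def)
    \<comment> \<open>\<open>u\<close> now takes \<open>h w\<close> and \<open>w\<close> takes
      \<open>h u\<close>; by the choice of \<open>u\<close> both are free of conflict, and no other
      value changes.\<close>
    have "{v\<in>S. F v (?h v)} \<subset> {v\<in>S. F v (h v)}"
    proof
      show "{v\<in>S. F v (?h v)} \<subseteq> {v\<in>S. F v (h v)}" using u by (auto split: if_splits)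
      have "w \<notin> {v\<in>S. F v (?h v)}" using u ne by auto
      then show "{v\<in>S. F v (?h v)} \<noteq> {v\<in>S. F v (h v)}" using w by blast
    qed
    then have "card {v\<in>S. F v (?h v)} < card {v\<in>S. F v (h v)}"
      by (intro psubset_card_mono) (use assms(1) in auto)
    from less.hyps[OF this bij] show ?thesis .
  qed
qed

lemma bij_betw_avoiding:
  assumes "finite S" "finite D" "card S = card D" "2 * t \<le> card S"
    and "\<And>w. w \<in> S \<Longrightarrow> card {c\<in>D. F w c} \<le> t"
    and "\<And>c. c \<in> D \<Longrightarrow> card {w\<in>S. F w c} \<le> t"
  obtains h where "bij_betw h S D" "\<And>w. w \<in> S \<Longrightarrow> \<not> F w (h w)"
proof -
  obtain h0 where "bij_betw h0 S D" using finite_same_card_bij[OF assms(1-3)] by blast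
  from bij_betw_avoiding_aux[OF assms(1) this assms(4-6)] that show thesis by blast
qed

text \<open>Two different cyclic shifts of an enumeration of \<open>A\<close> agree nowhere, so each
  pair in \<open>F\<close> excludes at most one of the \<open>card A\<close> shifts, and fewer pairs
  than shifts leave one over.\<close>

lemma permutation_avoiding:
  assumes "finite A" "finite F" "card F < card A"
  obtains s where "bij_betw s A A" "\<And>a. a \<in> A \<Longrightarrow> (a, s a) \<notin> F"
proof -
  define n where "n = card A"
  have n: "n > 0" using assms by (simp add: n_def)
  obtain e where e: "bij_betw e {0..<n} A"
    using ex_bij_betw_nat_finite[OF assms(1)] n_def by blast
  define i where "i = inv_into {0..<n} e"
  have i: "bij_betw i A {0..<n}" unfolding i_def by (rule bij_betw_inv_into[OF e])
  have ei: "e (i a) = a" if "a \<in> A" for a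
    using that e unfolding i_def by (simp add: bij_betw_inv_into_right)
  have ie: "i (e j) = j" if "j < n" for j
    using that e unfolding i_def by (simp add: bij_betw_inv_into_left)
  have iA: "i a < n" if "a \<in> A" for a using i that by (auto simp: bij_betw_def)
  have eA: "e j \<in> A" if "j < n" for j using e that by (auto simp: bij_betw_def)
  \<comment> \<open>The shift amounts that some forbidden pair would realize. Adding
    \<open>n\<close> first keeps the subtraction of naturals from being truncated.\<close>
  define T where "T = (\<lambda>(a, b). (i b + n - i a) mod n) ` (F \<inter> A \<times> A)"
  have "card T \<le> card (F \<inter> A \<times> A)" unfolding T_def using assms(2) by (intro card_image_le) auto
  also have "\<dots> \<le> card F" using assms(2) by (intro card_mono) auto
  also have "\<dots> < card {0..<n}" using assms by (simp add: n_def)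
  finally have "card T < card {0..<n}" .
  moreover have "finite T" unfolding T_def using assms(2) by simp
  ultimately have "\<not> {0..<n} \<subseteq> T" using card_mono leD by blast
  then obtain t where "t \<in> {0..<n}" "t \<notin> T" by blast
  then have t: "t < n" "t \<notin> T" by auto
  have shift: "(j + t) mod n = (if j + t < n then j + t else j + t - n)" if "j < n" for j
    using that t(1) by (auto simp: le_mod_geq)
  define s where "s a = e ((i a + t) mod n)" for a
  have sA: "s a \<in> A" for a unfolding s_def using n by (simp add: eA)
  have inj: "inj_on s A"
  proof (rule inj_onI)
    fix a b assume ab: "a \<in> A" "b \<in> A" "s a = s b"
    then have "i (s a) = i (s b)" by simp
    then have "(i a + t) mod n = (i b + t) mod n"
      unfolding s_def using n by (simp add: ie)
    then have "i a = i b"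
      using shift[OF iA[OF ab(1)]] shift[OF iA[OF ab(2)]] iA[OF ab(1)] iA[OF ab(2)] t(1)
      by (auto split: if_splits)
    then show "a = b" using ei ab by metis
  qed
  have "bij_betw s A A"
    unfolding bij_betw_def using inj sA assms(1)
    by (simp add: endo_inj_surj image_subset_iff)
  moreover have "(a, s a) \<notin> F" if a: "a \<in> A" for a
  proof
    assume "(a, s a) \<in> F"
    then have "(i (s a) + n - i a) mod n \<in> T" unfolding T_def using a sA by force
    moreover have "i (s a) = (i a + t) mod n" unfolding s_def using n by (simp add: ie)
    moreover have "((i a + t) mod n + n - i a) mod n = t"
      using shift[OF iA[OF a]] iA[OF a] t(1) by auto
    ultimately show False using t by simp
  qed
  ultimately show thesis using that by blast
qed

text \<open>Elements are discarded one at a time, keeping the average cost at most one: dropping an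
  element of positive cost lowers the sum by at least one, and if there is none, the sum is zero
  anyway.\<close>

lemma subset_with_small_sum:
  fixes c :: "'b \<Rightarrow> nat"
  assumes "finite I" "sum c I \<le> card I" "k \<le> card I"
  obtains T where "T \<subseteq> I" "card T = k" "sum c T \<le> k"
proof -
  have "\<exists>T\<subseteq>I. card T = k \<and> sum c T \<le> k"
    using assms
  proof (induction "card I" arbitrary: I)
    case 0
    then show ?case by auto
  next
    case (Suc n)
    show ?case
    proof (cases "k = card I")
      case True
      then show ?thesis using Suc.prems by blast
    next
      case False
      have "\<exists>a\<in>I. sum c (I - {a}) \<le> card (I - {a})"
      proof (cases "\<exists>a\<in>I. c a > 0")
        case True
        then obtain a where a: "a \<in> I" "c a > 0" by blast
        then have "sum c I = c a + sum c (I - {a})" using Suc.prems by (simp add: sum.remove)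
        then show ?thesis using a Suc.prems by (intro bexI[of _ a]) auto
      next
        case False
        moreover obtain a where "a \<in> I" using Suc.hyps(2) by fastforce
        ultimately show ?thesis by (intro bexI[of _ a]) auto
      qed
      then obtain a where a: "a \<in> I" "sum c (I - {a}) \<le> card (I - {a})" by blast
      have "card (I - {a}) = n" using a Suc by simp
      moreover have "k \<le> n" using False Suc by simp
      ultimately have "\<exists>T\<subseteq>I - {a}. card T = k \<and> sum c T \<le> k"
        using Suc.hyps(1)[of "I - {a}"] Suc.prems(1) a by simp
      then show ?thesis by blast
    qed
  qed
  then show thesis using that by blast
qed

text \<open>In the gluing step this gives the center of a star and its chosen neighbors exactly one
  block of the colors.\<close>

lemma bij_betw_with_image:
  assumes "finite S" "finite C" "card S = card C" "S' \<subseteq> S" "A \<subseteq> C" "card S' = card A"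
  obtains f where "bij_betw f S C" "f ` S' = A"
proof -
  have fin: "finite S'" "finite A" using assms finite_subset by blast+
  obtain f1 where f1: "bij_betw f1 S' A"
    using finite_same_card_bij[OF fin assms(6)] by blast
  have "card (S - S') = card (C - A)" using assms fin by (simp add: card_Diff_subset)
  then obtain f2 where f2: "bij_betw f2 (S - S') (C - A)"
    using finite_same_card_bij[of "S - S'" "C - A"] assms by blast
  define f where "f v = (if v \<in> S' then f1 v else f2 v)" for v
  have 1: "bij_betw f S' A" using f1 by (rule bij_betw_cong[THEN iffD1, rotated]) (simp add: f_def)
  have 2: "bij_betw f (S - S') (C - A)"
    using f2 by (rule bij_betw_cong[THEN iffD1, rotated]) (simp add: f_def)
  have "bij_betw f (S' \<union> (S - S')) (A \<union> (C - A))"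
    by (rule bij_betw_combine[OF 1 2]) auto
  moreover have "S' \<union> (S - S') = S" "A \<union> (C - A) = C" using assms by auto
  moreover have "f ` S' = A" using 1 by (simp add: bij_betw_def)
  ultimately show thesis using that by simp
qed

section \<open>Partial colorings of regular graphs without 4-cycles\<close>

lemma (in simple_graph) neighbors_sym: "u \<in> neighbors E v \<longleftrightarrow> v \<in> neighbors E u"
  by (simp add: neighbors_def insert_commute)

lemma (in simple_graph) neighbors_irrefl [simp]: "v \<notin> neighbors E v"
  using edges[of "{v}"] by (auto simp: neighbors_def)

lemma (in simple_graph) neighbors_subset: "neighbors E v \<subseteq> V"
  using edges by (auto simp: neighbors_def)

lemma (in simple_graph) finite_neighbors [simp]: "finite (neighbors E v)"
  using finite_subset[OF neighbors_subset finite_vertices] .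

lemma (in simple_graph) edge_iff: "{u, v} \<in> E \<longleftrightarrow> u \<in> neighbors E v"
  by (simp add: neighbors_def)

locale C4_free_regular_graph = simple_graph +
  fixes d :: nat
  assumes regular: "regular V E d" and C4_free: "\<not> contains_C4 E"
begin

abbreviation N :: "'a \<Rightarrow> 'a set" where "N \<equiv> neighbors E"

definition closed_nbh :: "'a \<Rightarrow> 'a set" where
  "closed_nbh v = insert v (N v)"

text \<open>A partial coloring is encoded as a total function together with the set \<open>R\<close>
  on which its values count.\<close>

definition proper_on :: "('a \<Rightarrow> 'c) \<Rightarrow> 'a set \<Rightarrow> bool" where
  "proper_on g R \<longleftrightarrow> (\<forall>u\<in>R. \<forall>v\<in>R. u \<in> N v \<longrightarrow> g u \<noteq> g v)"

lemma card_neighbors: "v \<in> V \<Longrightarrow> card (N v) = d"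
  using regular by (simp add: regular_def)

lemma finite_closed_nbh [simp]: "finite (closed_nbh v)"
  by (simp add: closed_nbh_def)

lemma card_closed_nbh: "v \<in> V \<Longrightarrow> card (closed_nbh v) = d + 1"
  by (simp add: closed_nbh_def card_neighbors)

lemma closed_nbh_subset: "v \<in> V \<Longrightarrow> closed_nbh v \<subseteq> V"
  using neighbors_subset by (auto simp: closed_nbh_def)

lemma neighbor_in_V: "u \<in> N v \<Longrightarrow> u \<in> V" "u \<in> N v \<Longrightarrow> v \<in> V"
  using neighbors_subset neighbors_sym by blast+

text \<open>A second common neighbor would close the 4-cycle \<open>u, z, u', z'\<close>. All later
  uses of the absence of 4-cycles go through this lemma.\<close>

lemma common_neighbor_unique:
  assumes "u \<noteq> u'" "z \<in> N u" "z \<in> N u'" "z' \<in> N u" "z' \<in> N u'"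
  shows "z = z'"
proof (rule ccontr)
  assume "z \<noteq> z'"
  moreover have "u \<noteq> z" "u \<noteq> z'" "u' \<noteq> z" "u' \<noteq> z'" using assms by auto
  ultimately have "distinct [u, z, u', z']" using assms(1) by auto
  moreover have "{u, z} \<in> E" "{z, u'} \<in> E" "{u', z'} \<in> E" "{z', u} \<in> E"
    using assms(2-5) by (auto simp: neighbors_def insert_commute)
  ultimately show False using C4_free unfolding contains_C4_def by blast
qed

lemma card_common_neighbors_le: "u \<noteq> u' \<Longrightarrow> card (N u \<inter> N u') \<le> 1"
  using common_neighbor_unique by (auto simp: card_le_Suc0_iff_eq)

section \<open>Reduction to partial colorings\<close>

lemma card_b_coloring_le:
  assumes "b_coloring V E f C"
  shows "card C \<le> d + 1"
proof -
  have "C \<noteq> {}" using b_coloring_image_eq[OF assms] vertices_nonempty by auto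
  then obtain c v where "c \<in> C" "v \<in> V" "f ` N v = C - {c}"
    using assms unfolding b_coloring_def by blast
  then have "card (C - {c}) \<le> d" using card_image_le[of "N v" f] card_neighbors by simp
  then show ?thesis using \<open>c \<in> C\<close> by (simp add: card_Diff_singleton)
qed

text \<open>A vertex has only \<open>d\<close> neighbors, so one of the \<open>d + 1\<close> colors
  is always free.\<close>

lemma greedy_extension:
  fixes g :: "'a \<Rightarrow> 'c"
  assumes "finite W" "W \<subseteq> V" "proper_on g R" "g ` R \<subseteq> C" "finite C" "card C = d + 1"
  shows "\<exists>f. (\<forall>v\<in>R. f v = g v) \<and> proper_on f (R \<union> W) \<and> f ` (R \<union> W) \<subseteq> C"
  using assms(1,2)
proof (induction W)
  case empty
  then show ?case using assms by auto
next
  case (insert w W)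
  then obtain f where f: "\<forall>v\<in>R. f v = g v" "proper_on f (R \<union> W)" "f ` (R \<union> W) \<subseteq> C" by auto
  show ?case
  proof (cases "w \<in> R")
    case True
    then have "R \<union> insert w W = R \<union> W" by auto
    then show ?thesis using f by auto
  next
    case False
    \<comment> \<open>\<open>f\<close> also has arbitrary values at neighbors not yet colored;
      avoiding these too still excludes at most \<open>d\<close> colors.\<close>
    have "card (f ` N w) < card C"
      using card_image_le[of "N w" f] card_neighbors insert.prems assms(6) by simp
    then have "\<not> C \<subseteq> f ` N w" using card_mono[of "f ` N w" C] by auto
    then obtain c where c: "c \<in> C" "c \<notin> f ` N w" by blast
    have "proper_on (f(w := c)) (R \<union> insert w W)"
      using f(2) c unfolding proper_on_def by (auto simp: neighbors_sym)
    moreover have "(f(w := c)) ` (R \<union> insert w W) \<subseteq> C" using f(3) c by auto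
    moreover have "\<forall>v\<in>R. (f(w := c)) v = g v" using f(1) False by auto
    ultimately show ?thesis by blast
  qed
qed

text \<open>The closed neighborhoods of the dominating vertices lie inside \<open>R\<close>, so the
  greedy extension cannot spoil what they see. The upper bound comes from counting the neighbors of
  a dominating vertex.\<close>

lemma b_chromatic_number_eqI:
  fixes g :: "'a \<Rightarrow> nat"
  assumes "proper_on g R" "g ` R \<subseteq> C" "finite C" "card C = d + 1" "R \<subseteq> V"
    and dom: "\<And>c. c \<in> C \<Longrightarrow> \<exists>v\<in>R. closed_nbh v \<subseteq> R \<and> g v = c \<and> C \<subseteq> g ` closed_nbh v"
  shows "b_chromatic_number V E = d + 1"
proof -
  from greedy_extension[OF finite_vertices subset_refl assms(1-4)] assms(5)
  obtain f where f: "\<forall>v\<in>R. f v = g v" "proper_on f V" "f ` V \<subseteq> C"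
    by (metis Un_absorb1)
  have "coloring V E f C"
    unfolding coloring_def
  proof (intro conjI allI impI)
    fix u v assume "{u, v} \<in> E"
    then have "u \<in> N v" by (simp add: edge_iff)
    then show "f u \<noteq> f v" using f(2) neighbor_in_V unfolding proper_on_def by blast
  qed (use f in auto)
  moreover have "\<exists>v\<in>V. f v = c \<and> f ` N v = C - {c}" if c: "c \<in> C" for c
  proof -
    obtain v where v: "v \<in> R" "closed_nbh v \<subseteq> R" "g v = c" "C \<subseteq> g ` closed_nbh v"
      using dom[OF c] by blast
    have vV: "v \<in> V" using v assms(5) by blast
    have "f ` closed_nbh v = g ` closed_nbh v" using f(1) v(2) by (intro image_cong) auto
    then have "C \<subseteq> f ` closed_nbh v" using v by simp
    then have "C - {c} \<subseteq> f ` N v" using f(1) v unfolding closed_nbh_def by auto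
    moreover have "f ` N v \<subseteq> C - {c}"
    proof
      fix b assume "b \<in> f ` N v"
      then obtain u where u: "u \<in> N v" "b = f u" by blast
      then have "f u \<noteq> f v" using f(2) neighbor_in_V unfolding proper_on_def by blast
      moreover have "f u \<in> C" using f(3) u neighbor_in_V by blast
      ultimately show "b \<in> C - {c}" using u f(1) v by auto
    qed
    ultimately show ?thesis using vV f(1) v by auto
  qed
  ultimately have "b_coloring V E f C" unfolding b_coloring_def by blast
  then have "d + 1 \<in> {card C | C. \<exists>f :: 'a \<Rightarrow> nat. b_coloring V E f C}"
    using assms(4) by force
  then show ?thesis
    unfolding b_chromatic_number_def
    using finite_b_coloring_cards[OF finite_vertices] card_b_coloring_le
    by (intro Max_eqI) auto
qed

text \<open>Induction on \<open>T\<close>. For a new neighbor \<open>y\<close> only \<open>S\<close>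
  is still uncolored, and it must receive the colors missing on \<open>K\<close>. As
  \<open>K\<close> holds at most \<open>x\<close>, \<open>y\<close> and one common neighbor,
  \<open>S\<close> has at least \<open>d - 2\<close> vertices, hence at least twice as many as there
  are earlier neighbors, as the exchange argument requires.\<close>

lemma closed_nbh_coloring_extends:
  fixes g0 :: "'a \<Rightarrow> 'c"
  assumes x: "x \<in> V" and C: "finite C" "card C = d + 1" and g0: "bij_betw g0 (closed_nbh x) C"
    and T: "T \<subseteq> N x" "2 * card T \<le> d"
  obtains g where "\<And>v. v \<in> closed_nbh x \<Longrightarrow> g v = g0 v"
    "proper_on g (closed_nbh x \<union> (\<Union>y\<in>T. N y))"
    "\<And>y. y \<in> T \<Longrightarrow> bij_betw g (closed_nbh y) C"
proof -
  have "finite T" using finite_subset[OF T(1)] by simp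
  then have "\<exists>g. (\<forall>v\<in>closed_nbh x. g v = g0 v) \<and>
    proper_on g (closed_nbh x \<union> (\<Union>y\<in>T. N y)) \<and> (\<forall>y\<in>T. bij_betw g (closed_nbh y) C)"
    using T
  proof (induction T)
    case empty
    have "proper_on g0 (closed_nbh x)"
      using g0 unfolding proper_on_def bij_betw_def inj_on_def by auto
    then show ?case by auto
  next
    case (insert y T)
    then obtain g where g: "\<And>v. v \<in> closed_nbh x \<Longrightarrow> g v = g0 v"
      and proper: "proper_on g (closed_nbh x \<union> (\<Union>y\<in>T. N y))"
      and bij: "\<And>y. y \<in> T \<Longrightarrow> bij_betw g (closed_nbh y) C" by auto
    have gx: "bij_betw g (closed_nbh x) C" using g0 g bij_betw_cong by metis
    have yx: "y \<in> N x" and TN: "T \<subseteq> N x" using insert by auto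
    have yV: "y \<in> V" using yx neighbor_in_V by blast
    define S where "S = N y - closed_nbh x"
    define K where "K = closed_nbh x \<inter> closed_nbh y"
    define D where "D = C - g ` K"
    \<comment> \<open>A conflict: \<open>w\<close> is adjacent to a vertex of color \<open>c\<close>
      behind an earlier neighbor \<open>y'\<close>.\<close>
    define F where "F w c \<longleftrightarrow> (\<exists>y'\<in>T. \<exists>v\<in>N y' - closed_nbh x. v \<in> N w \<and> g v = c)" for w c
    have SK: "closed_nbh y = S \<union> K" "S \<inter> K = {}"
      using yx unfolding S_def K_def closed_nbh_def by auto
    have finS: "finite S" "finite K" unfolding S_def K_def by auto
    have injK: "inj_on g K" and gKC: "g ` K \<subseteq> C"
      using gx unfolding bij_betw_def K_def by (auto intro: inj_on_subset)
    have cards: "card S + card K = d + 1"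
      using card_closed_nbh[OF yV] card_Un_disjoint[OF finS SK(2)] SK(1) by simp
    have "card D + card K = d + 1"
      unfolding D_def using C gKC injK card_mono[OF C(1) gKC] finS
      by (simp add: card_Diff_subset card_image)
    then have eq: "card S = card D" using cards by simp
    have "card K \<le> 3"
    proof -
      have "K \<subseteq> insert x (insert y (N x \<inter> N y))" unfolding K_def closed_nbh_def by auto
      then have "card K \<le> card (insert x (insert y (N x \<inter> N y)))" by (intro card_mono) auto
      also have "\<dots> \<le> Suc (Suc (card (N x \<inter> N y)))"
        by (simp add: card_insert_if)
      also have "\<dots> \<le> 3"
      proof -
        have "x \<noteq> y" using yx by auto
        from card_common_neighbors_le[OF this] show ?thesis by simp
      qed
      finally show ?thesis .
    qed
    then have big: "2 * card T \<le> card S" using cards insert.prems insert.hyps by simp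
    have nx: "w \<noteq> y'" if "w \<notin> closed_nbh x" "y' \<in> N x" for w y'
      using that unfolding closed_nbh_def by auto
    \<comment> \<open>\<open>w\<close> and \<open>y'\<close> have at most one common neighbor, so
      \<open>y'\<close> forbids at most one color at \<open>w\<close>.\<close>
    have row: "card {c\<in>D. F w c} \<le> card T" if w: "w \<in> S" for w
    proof -
      have "{c\<in>D. F w c} \<subseteq> {c. \<exists>y'\<in>T. \<exists>v\<in>N y' \<inter> N w. c = g v}" unfolding F_def by auto
      moreover have "finite {c. \<exists>y'\<in>T. \<exists>v\<in>N y' \<inter> N w. c = g v}"
        by (rule finite_subset[of _ "g ` N w"]) auto
      ultimately have "card {c\<in>D. F w c} \<le> card {c. \<exists>y'\<in>T. \<exists>v\<in>N y' \<inter> N w. c = g v}"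
        by (rule card_mono[rotated])
      also have "\<dots> \<le> card T"
      proof (rule card_Collect_functional_le[OF insert.hyps(1)])
        fix y' c c' assume "y' \<in> T" "\<exists>v\<in>N y' \<inter> N w. c = g v" "\<exists>v\<in>N y' \<inter> N w. c' = g v"
        moreover have "w \<noteq> y'" using nx w TN \<open>y' \<in> T\<close> unfolding S_def by blast
        ultimately show "c = c'" using common_neighbor_unique by blast
      qed
      finally show ?thesis .
    qed
    \<comment> \<open>As \<open>g\<close> is injective on \<open>closed_nbh y'\<close>, the color
      \<open>c\<close> fixes \<open>v\<close>, and then \<open>w\<close> is the only common neighbor
      of \<open>v\<close> and \<open>y\<close>.\<close>
    have col: "card {w\<in>S. F w c} \<le> card T" if "c \<in> D" for c
    proof -
      define Q where "Q y' w \<longleftrightarrow> (\<exists>v\<in>N y' - closed_nbh x. v \<in> N w \<and> g v = c \<and> w \<in> S)" for y' w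
      have "{w\<in>S. F w c} = {w. \<exists>y'\<in>T. Q y' w}" unfolding F_def Q_def by auto
      also have "card \<dots> \<le> card T"
      proof (rule card_Collect_functional_le[OF insert.hyps(1)])
        fix y' w w' assume y': "y' \<in> T" and "Q y' w" "Q y' w'"
        then obtain v v' where v: "v \<in> N y'" "v \<notin> closed_nbh x" "v \<in> N w" "g v = c" "w \<in> S"
          and v': "v' \<in> N y'" "v' \<in> N w'" "g v' = c" "w' \<in> S"
          unfolding Q_def by blast
        have "v = v'"
          using bij[OF y'] v v' unfolding bij_betw_def inj_on_def closed_nbh_def by auto
        moreover have "v \<noteq> y" using nx v(2) yx by blast
        ultimately show "w = w'"
          using common_neighbor_unique[of v y w w'] v v' neighbors_sym unfolding S_def by blast
      qed
      finally show ?thesis .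
    qed
    obtain h where h: "bij_betw h S D" "\<And>w. w \<in> S \<Longrightarrow> \<not> F w (h w)"
      using bij_betw_avoiding[OF finS(1) _ eq big row col] C(1) unfolding D_def by blast
    define g' where "g' v = (if v \<in> S then h v else g v)" for v
    \<comment> \<open>\<open>y\<close> and \<open>y'\<close> share only the neighbor
      \<open>x\<close>, so coloring \<open>S\<close> leaves the neighborhood of \<open>y'\<close>
      untouched.\<close>
    have disj: "S \<inter> closed_nbh y' = {}" if "y' \<in> T" for y'
    proof -
      have ne: "y' \<noteq> y" using that insert.hyps by auto
      have y'x: "y' \<in> N x" using that TN by auto
      have "w = x" if "w \<in> S" "w \<in> N y'" for w
        using common_neighbor_unique[OF ne, of w x] that y'x yx neighbors_sym
        unfolding S_def by blast
      moreover have "y' \<notin> S" "x \<notin> S" using y'x unfolding S_def closed_nbh_def by auto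
      ultimately show ?thesis unfolding closed_nbh_def by auto
    qed
    have g'x: "g' v = g v" if "v \<in> closed_nbh x" for v using that unfolding g'_def S_def by auto
    have "bij_betw g' (closed_nbh y') C" if "y' \<in> T" for y'
    proof (rule bij_betw_cong[THEN iffD1, OF _ bij[OF that]])
      fix v assume "v \<in> closed_nbh y'"
      then show "g v = g' v" using disj[OF that] unfolding g'_def by auto
    qed
    moreover have "bij_betw g' (closed_nbh y) C"
    proof -
      have "bij_betw g' S D"
        by (rule bij_betw_cong[THEN iffD1, OF _ h(1)]) (simp add: g'_def)
      moreover have "bij_betw g' K (g ` K)"
        by (rule bij_betw_cong[THEN iffD1, OF _ inj_on_imp_bij_betw[OF injK]]) (use g'x K_def in auto)
      ultimately have "bij_betw g' (S \<union> K) (D \<union> g ` K)"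
        by (rule bij_betw_combine) (auto simp: D_def)
      moreover have "D \<union> g ` K = C" using gKC unfolding D_def by auto
      ultimately show ?thesis using SK by simp
    qed
    moreover have "proper_on g' (closed_nbh x \<union> (\<Union>y\<in>insert y T. N y))"
    proof -
      let ?R = "closed_nbh x \<union> (\<Union>y\<in>T. N y)"
      \<comment> \<open>A neighbor of \<open>w\<close> outside \<open>closed_nbh y\<close> is not
        \<open>x\<close>, since \<open>w\<close> lies outside \<open>closed_nbh x\<close>, and is
        not in \<open>N x\<close>, since it would share both \<open>w\<close> and \<open>x\<close>
        with \<open>y\<close>. Only the conflicts recorded in \<open>F\<close> remain.\<close>
      have new: "g' w \<noteq> g' v" if w: "w \<in> S" and v: "v \<in> ?R \<union> S" and adj: "v \<in> N w" for w v
      proof (cases "v \<in> closed_nbh y")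
        case True
        have "w \<in> closed_nbh y" "w \<noteq> v" using w adj SK by auto
        then show ?thesis
          using True \<open>bij_betw g' (closed_nbh y) C\<close> unfolding bij_betw_def inj_on_def by blast
      next
        case False
        then have vS: "v \<notin> S" "v \<noteq> y" using SK unfolding closed_nbh_def by auto
        have wy: "w \<in> N y" "w \<notin> closed_nbh x" using w unfolding S_def by auto
        have "v \<notin> closed_nbh x"
        proof
          assume "v \<in> closed_nbh x"
          then consider "v = x" | "v \<in> N x" unfolding closed_nbh_def by auto
          then show False
          proof cases
            case 1
            then show False using adj wy neighbors_sym unfolding closed_nbh_def by blast
          next
            case 2
            then have "w = x"
              using common_neighbor_unique[OF vS(2), of w x] adj wy yx neighbors_sym by blast
            then show False using wy unfolding closed_nbh_def by auto
          qed
        qed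
        then have "F w (g v)" using v vS adj unfolding F_def by auto
        then have "h w \<noteq> g v" using h(2)[OF w] by auto
        then show ?thesis using w vS unfolding g'_def by auto
      qed
      have "closed_nbh x \<union> (\<Union>y\<in>insert y T. N y) \<subseteq> ?R \<union> S" unfolding S_def by auto
      moreover have "proper_on g' (?R \<union> S)"
        unfolding proper_on_def
      proof (intro ballI impI)
        fix u v assume uv: "u \<in> ?R \<union> S" "v \<in> ?R \<union> S" "u \<in> N v"
        show "g' u \<noteq> g' v"
        proof (cases "u \<in> S \<or> v \<in> S")
          case True
          then show ?thesis using new uv neighbors_sym by metis
        next
          case False
          then show ?thesis using proper uv unfolding proper_on_def g'_def by auto
        qed
      qed
      ultimately show ?thesis unfolding proper_on_def by (meson subsetD)
    qed
    moreover have "\<forall>v\<in>closed_nbh x. g' v = g0 v" using g g'x by simp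
    ultimately show ?case by (intro exI[of _ g'] conjI) auto
  qed
  then show thesis using that by blast
qed

subsection \<open>Small edge cuts\<close>

text \<open>Either the edge connectivity is below \<open>d\<close>, or some minimum cut is not a
  star; both give a disconnecting \<open>U\<close> of at most \<open>d\<close> edges that is no
  star. \<open>X\<close> is the component of a vertex \<open>a\<close> after deleting
  \<open>U\<close>. If a side were a single vertex, \<open>U\<close> would contain its
  \<open>d\<close> edges and hence be its star. Cut edges are counted as ordered pairs leading from
  \<open>X\<close> to \<open>Y\<close>.\<close>

lemma small_cut_if_not_super_edge_connected:
  assumes "d > 0" "\<not> super_edge_connected V E d"
  obtains X Y where "X \<union> Y = V" "X \<inter> Y = {}" "card X \<ge> 2" "card Y \<ge> 2"
    "card (SIGMA u:X. N u \<inter> Y) \<le> d"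
proof -
  let ?M = "{card U | U. U \<subseteq> E \<and> (\<not> connected_graph V (E - U) \<or> card V = 1)}"
  have finE: "finite E"
    by (rule finite_subset[of _ "Pow V"]) (use edges finite_vertices in auto)
  obtain v0 where v0: "v0 \<in> V" using vertices_nonempty by blast
  have other: "\<exists>u\<in>V. u \<noteq> v" if "v \<in> V" for v
  proof -
    have "N v \<noteq> {}" using card_neighbors[OF that] assms(1) by auto
    then show ?thesis using neighbor_in_V by fastforce
  qed
  \<comment> \<open>This disposes of the one-vertex alternative in
    \<open>edge_connectivity\<close>.\<close>
  have V1: "card V \<noteq> 1"
  proof
    assume "card V = 1"
    then obtain a where "V = {a}" by (auto simp: card_1_singleton_iff)
    then show False using other by auto
  qed
  have star_eq: "incident_edges E v = (\<lambda>u. {u, v}) ` N v" for v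
  proof
    show "incident_edges E v \<subseteq> (\<lambda>u. {u, v}) ` N v"
    proof
      fix e assume e: "e \<in> incident_edges E v"
      then have "card e = 2" "v \<in> e" "e \<in> E" using edges unfolding incident_edges_def by auto
      then obtain u where "e = {u, v}" by (auto simp: card_2_iff)
      then show "e \<in> (\<lambda>u. {u, v}) ` N v" using \<open>e \<in> E\<close> by (auto simp: edge_iff)
    qed
  qed (auto simp: incident_edges_def neighbors_def)
  have star_card: "card (incident_edges E v) = d" if "v \<in> V" for v
  proof -
    have "inj_on (\<lambda>u. {u, v}) (N v)" by (auto simp: inj_on_def doubleton_eq_iff)
    then show ?thesis using star_eq card_neighbors[OF that] by (simp add: card_image)
  qed
  have star_cut: "\<not> connected_graph V (E - incident_edges E v)" if v: "v \<in> V" for v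
  proof
    assume conn: "connected_graph V (E - incident_edges E v)"
    obtain u where u: "u \<in> V" "u \<noteq> v" using other[OF v] by blast
    have "(\<lambda>x y. {x, y} \<in> E - incident_edges E v)\<^sup>*\<^sup>* v u"
      using conn v u unfolding connected_graph_def by blast
    then show False
      by (cases rule: converse_rtranclpE) (use u in \<open>auto simp: incident_edges_def\<close>)
  qed
  have M: "finite ?M" "d \<in> ?M"
  proof -
    show "finite ?M" by (rule finite_subset[of _ "card ` Pow E"]) (use finE in auto)
    have "incident_edges E v0 \<subseteq> E" by (auto simp: incident_edges_def)
    then show "d \<in> ?M" using star_card[OF v0] star_cut[OF v0] by force
  qed
  have le: "edge_connectivity V E \<le> d"
    unfolding edge_connectivity_def by (rule Min_le[OF M])
  have "\<exists>U. U \<subseteq> E \<and> \<not> connected_graph V (E - U) \<and> card U \<le> d \<and> (\<forall>v\<in>V. U \<noteq> incident_edges E v)"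
  proof (cases "edge_connectivity V E = d")
    case True
    then show ?thesis
      using assms(2) regular unfolding super_edge_connected_def minimum_edge_cut_def edge_cut_def
      by auto
  next
    case False
    have "edge_connectivity V E \<in> ?M"
      unfolding edge_connectivity_def by (rule Min_in) (use M in auto)
    then obtain U where "U \<subseteq> E" "\<not> connected_graph V (E - U)" "card U = edge_connectivity V E"
      using V1 by auto
    then show ?thesis using False le star_card by (intro exI[of _ U]) auto
  qed
  then obtain U where U: "U \<subseteq> E" "\<not> connected_graph V (E - U)" "card U \<le> d"
    and no_star: "\<And>v. v \<in> V \<Longrightarrow> U \<noteq> incident_edges E v" by blast
  from U(2) obtain a b where ab: "a \<in> V" "b \<in> V" "\<not> (\<lambda>x y. {x, y} \<in> E - U)\<^sup>*\<^sup>* a b"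
    unfolding connected_graph_def by blast
  define X where "X = {w\<in>V. (\<lambda>x y. {x, y} \<in> E - U)\<^sup>*\<^sup>* a w}"
  define Y where "Y = V - X"
  define P where "P = (SIGMA u:X. N u \<inter> Y)"
  have XY: "X \<union> Y = V" "X \<inter> Y = {}" unfolding Y_def X_def by auto
  have aX: "a \<in> X" and bY: "b \<in> Y" using ab unfolding X_def Y_def by auto
  have crossing: "{u, v} \<in> U" if "u \<in> X" "v \<in> Y" "{u, v} \<in> E" for u v
  proof (rule ccontr)
    assume "{u, v} \<notin> U"
    then have "(\<lambda>x y. {x, y} \<in> E - U)\<^sup>*\<^sup>* a v"
      using that unfolding X_def by (auto intro: rtranclp.rtrancl_into_rtrancl)
    then show False using that unfolding X_def Y_def by auto
  qed
  have finU: "finite U" using U(1) finE finite_subset by blast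
  have "card P \<le> card U"
  proof (rule card_inj_on_le[OF _ _ finU])
    show "inj_on (\<lambda>(u, v). {u, v}) P"
      using XY(2) unfolding inj_on_def P_def by (auto simp: doubleton_eq_iff)
    show "(\<lambda>(u, v). {u, v}) ` P \<subseteq> U"
      using crossing unfolding P_def by (auto simp: edge_iff neighbors_sym)
  qed
  then have "card P \<le> d" using U(3) by simp
  have not_single: False if "v \<in> V" "incident_edges E v \<subseteq> U" for v
    using card_subset_eq[OF finU that(2)] card_mono[OF finU that(2)] star_card U(3) no_star that
    by auto
  have "X \<noteq> {a}"
  proof
    assume "X = {a}"
    have "incident_edges E a \<subseteq> U"
    proof
      fix e assume "e \<in> incident_edges E a"
      then obtain u where u: "u \<in> N a" "e = {u, a}" using star_eq by auto
      then have "u \<in> Y" using neighbor_in_V(1)[OF u(1)] \<open>X = {a}\<close> unfolding Y_def by auto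
      then show "e \<in> U" using crossing[OF aX, of u] u by (auto simp: edge_iff insert_commute neighbors_sym)
    qed
    then show False using not_single ab by blast
  qed
  moreover have "Y \<noteq> {b}"
  proof
    assume "Y = {b}"
    have "incident_edges E b \<subseteq> U"
    proof
      fix e assume "e \<in> incident_edges E b"
      then obtain u where u: "u \<in> N b" "e = {u, b}" using star_eq by auto
      then have "u \<in> X" using neighbor_in_V(1)[OF u(1)] \<open>Y = {b}\<close> XY by auto
      then show "e \<in> U" using crossing[OF _ bY, of u] u by (auto simp: edge_iff)
    qed
    then show False using not_single ab by blast
  qed
  moreover have "card Z \<ge> 2" if z: "z \<in> Z" "Z \<noteq> {z}" "finite Z" for z :: 'a and Z
  proof -
    obtain z' where "z' \<in> Z" "z' \<noteq> z" using z by blast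
    then have "card {z, z'} \<le> card Z" using z by (intro card_mono) auto
    then show ?thesis using \<open>z' \<noteq> z\<close> by simp
  qed
  moreover have "finite X" "finite Y" using finite_vertices unfolding X_def Y_def by auto
  ultimately have "card X \<ge> 2" "card Y \<ge> 2" using aX bY by blast+
  then show thesis using that[OF XY] \<open>card P \<le> d\<close> unfolding P_def by blast
qed

text \<open>Suppose every vertex of \<open>X\<close> except possibly \<open>x\<close> carries a cut
  edge. If \<open>x\<close> has no neighbor in \<open>X\<close>, it has \<open>d\<close> cut edges
  and another vertex has one more. Otherwise take a neighbor \<open>u\<close> in \<open>X\<close>:
  the neighborhoods of \<open>x\<close> and \<open>u\<close> within \<open>X\<close> overlap in at
  most \<open>d - 3\<close> vertices, so these two carry at least \<open>d + 3 - card X\<close> cut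
  edges and the others at least \<open>card X - 2\<close>, more than \<open>d\<close> in
  total.\<close>

lemma two_interior_vertices:
  assumes XY: "X \<union> Y = V" "X \<inter> Y = {}" and X2: "card X \<ge> 2"
    and cut: "card (SIGMA u:X. N u \<inter> Y) \<le> d" and "d > 0"
    and few_triangles: "\<And>u v. u \<in> N v \<Longrightarrow> card (N u \<inter> N v) + 3 \<le> d"
  obtains x1 x2 where "x1 \<noteq> x2" "x1 \<in> X" "x2 \<in> X" "N x1 \<subseteq> X" "N x2 \<subseteq> X"
proof (rule ccontr)
  assume contra: "\<not> thesis"
  have finX: "finite X" using XY finite_vertices by (metis finite_Un)
  have "\<exists>x\<in>X. \<forall>w\<in>X - {x}. \<not> N w \<subseteq> X"
  proof (cases "\<exists>x\<in>X. N x \<subseteq> X")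
    case True
    then show ?thesis using contra that by blast
  next
    case False
    moreover have "X \<noteq> {}" using X2 by auto
    ultimately show ?thesis by blast
  qed
  then obtain x where x: "x \<in> X" and bd: "\<And>w. w \<in> X - {x} \<Longrightarrow> \<not> N w \<subseteq> X" by blast
  define c where "c w = card (N w \<inter> Y)" for w
  have c1: "c w \<ge> 1" if "w \<in> X - {x}" for w
  proof -
    have "N w \<inter> Y \<noteq> {}" using bd[OF that] neighbors_subset XY by blast
    then show ?thesis unfolding c_def by (simp add: Suc_le_eq card_gt_0_iff)
  qed
  have split: "card (N w \<inter> X) + c w = d" if "w \<in> X" for w
  proof -
    have "N w = (N w \<inter> X) \<union> (N w \<inter> Y)" using neighbors_subset XY by blast
    moreover have "card ((N w \<inter> X) \<union> (N w \<inter> Y)) = card (N w \<inter> X) + card (N w \<inter> Y)"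
      using XY by (intro card_Un_disjoint) auto
    moreover have "card (N w) = d" using that XY card_neighbors by blast
    ultimately show ?thesis unfolding c_def by simp
  qed
  have rest: "card Z \<le> sum c Z" if "Z \<subseteq> X - {x}" for Z
    using sum_mono[of Z "\<lambda>_. 1" c] c1 that by auto
  have tot: "sum c X \<le> d" using cut finX unfolding c_def by (simp add: card_SigmaI)
  have tot_x: "sum c X = c x + sum c (X - {x})" using finX x by (simp add: sum.remove)
  show False
  proof (cases "N x \<inter> X = {}")
    case True
    then have "c x = d" using split[OF x] by simp
    moreover have "card (X - {x}) \<ge> 1" using X2 x finX by simp
    ultimately show False using tot tot_x rest[of "X - {x}"] by simp
  next
    case False
    then obtain u where u: "u \<in> N x" "u \<in> X" by blast
    then have "u \<noteq> x" by auto
    have "sum c (X - {x}) = c u + sum c (X - {x} - {u})"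
      using finX u \<open>u \<noteq> x\<close> by (simp add: sum.remove)
    moreover have "card (X - {x} - {u}) + 2 = card X"
      using finX u x \<open>u \<noteq> x\<close> X2 by simp
    moreover have "card (X - {x} - {u}) \<le> sum c (X - {x} - {u})" by (rule rest) auto
    moreover have "card (N x \<inter> X) + card (N u \<inter> X) + 3 \<le> card X + d"
    proof -
      have "card (N x \<inter> X) + card (N u \<inter> X)
        = card (N x \<inter> X \<union> N u \<inter> X) + card (N x \<inter> X \<inter> (N u \<inter> X))"
        by (rule card_Un_Int) auto
      moreover have "card (N x \<inter> X \<union> N u \<inter> X) \<le> card X" using finX by (intro card_mono) auto
      moreover have "card (N x \<inter> X \<inter> (N u \<inter> X)) \<le> card (N u \<inter> N x)" by (intro card_mono) auto
      ultimately show ?thesis using few_triangles[OF u(1)] by linarith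
    qed
    ultimately show False using split[OF x] split[OF u(2)] tot tot_x by linarith
  qed
qed

text \<open>At most \<open>d\<close> vertices of \<open>X\<close> are not interior. Two interior
  vertices share at most one neighbor, so their numbers of interior neighbors add up to at least
  \<open>d - 1\<close>; if both were at most \<open>k - 1\<close>, the sum would be at most
  \<open>d - 2\<close>.\<close>

lemma interior_vertex_with_interior_neighbors:
  assumes XY: "X \<union> Y = V" "X \<inter> Y = {}" and X2: "card X \<ge> 2"
    and cut: "card (SIGMA u:X. N u \<inter> Y) \<le> d" and "d > 0"
    and few_triangles: "\<And>u v. u \<in> N v \<Longrightarrow> card (N u \<inter> N v) + 3 \<le> d"
    and k: "2 * k \<le> d"
  obtains x where "x \<in> X" "N x \<subseteq> X" "k \<le> card {y\<in>N x. N y \<subseteq> X}"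
proof -
  obtain x1 x2 where x: "x1 \<noteq> x2" "x1 \<in> X" "x2 \<in> X" "N x1 \<subseteq> X" "N x2 \<subseteq> X"
    using two_interior_vertices[OF assms(1-6)] by metis
  have finX: "finite X" using XY finite_vertices by (metis finite_Un)
  define B where "B = {w\<in>X. \<not> N w \<subseteq> X}"
  have finB: "finite B" unfolding B_def using finX by simp
  have "B \<subseteq> fst ` (SIGMA u:X. N u \<inter> Y)"
  proof
    fix w assume w: "w \<in> B"
    then obtain v where "v \<in> N w" "v \<notin> X" unfolding B_def by blast
    moreover have "v \<in> Y" using calculation neighbors_subset XY by blast
    ultimately have "(w, v) \<in> (SIGMA u:X. N u \<inter> Y)" using w unfolding B_def by simp
    then show "w \<in> fst ` (SIGMA u:X. N u \<inter> Y)" by force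
  qed
  moreover have finP: "finite (SIGMA u:X. N u \<inter> Y)" using finX by simp
  ultimately have "card B \<le> d" using cut by (meson le_trans surj_card_le)
  have split: "card {y\<in>N x. N y \<subseteq> X} + card (N x \<inter> B) = d" if x: "x \<in> X" "N x \<subseteq> X" for x
  proof -
    have "N x = {y\<in>N x. N y \<subseteq> X} \<union> (N x \<inter> B)" using x unfolding B_def by blast
    moreover have "card ({y\<in>N x. N y \<subseteq> X} \<union> (N x \<inter> B)) = card {y\<in>N x. N y \<subseteq> X} + card (N x \<inter> B)"
      unfolding B_def by (intro card_Un_disjoint) auto
    moreover have "card (N x) = d" using x XY card_neighbors by blast
    ultimately show ?thesis by simp
  qed
  have "card (N x1 \<inter> B) + card (N x2 \<inter> B)
    = card (N x1 \<inter> B \<union> N x2 \<inter> B) + card (N x1 \<inter> B \<inter> (N x2 \<inter> B))"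
    by (rule card_Un_Int) auto
  moreover have "card (N x1 \<inter> B \<union> N x2 \<inter> B) \<le> card B" using finB by (intro card_mono) auto
  moreover have "card (N x1 \<inter> B \<inter> (N x2 \<inter> B)) \<le> card (N x1 \<inter> N x2)" by (intro card_mono) auto
  moreover note card_common_neighbors_le[OF x(1)] split[OF x(2,4)] split[OF x(3,5)]
  ultimately have "k \<le> card {y\<in>N x1. N y \<subseteq> X} \<or> k \<le> card {y\<in>N x2. N y \<subseteq> X}"
    using k \<open>card B \<le> d\<close> by linarith
  then show thesis using that x by blast
qed

text \<open>There are at least as many cut edges at \<open>N x\<close> as non-interior neighbors of \<open>x\<close>, so on average at most
  one of the remaining cut edges is at distance two from \<open>x\<close> behind a given interior neighbor.\<close>

lemma interior_star:
  assumes XY: "X \<union> Y = V" "X \<inter> Y = {}" and X2: "card X \<ge> 2"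
    and cut: "card (SIGMA u:X. N u \<inter> Y) \<le> d" and "d > 0"
    and few_triangles: "\<And>u v. u \<in> N v \<Longrightarrow> card (N u \<inter> N v) + 3 \<le> d"
    and k: "2 * k \<le> d"
  obtains x T where "x \<in> X" "N x \<subseteq> X" "T \<subseteq> N x" "card T = k" "\<And>y. y \<in> T \<Longrightarrow> N y \<subseteq> X"
    "card (SIGMA u:(\<Union>y\<in>T. N y) - closed_nbh x. N u \<inter> Y) \<le> k"
proof -
  obtain x where x: "x \<in> X" "N x \<subseteq> X" "k \<le> card {y\<in>N x. N y \<subseteq> X}"
    using interior_vertex_with_interior_neighbors[OF assms] by blast
  have finX: "finite X" using XY finite_vertices by (metis finite_Un)
  define I where "I = {y\<in>N x. N y \<subseteq> X}"
  define cut_edges where "cut_edges W = (SIGMA u:W. N u \<inter> Y)" for W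
  define c where "c y = card (cut_edges (N y - closed_nbh x))" for y
  have finc: "finite (cut_edges W)" if "finite W" for W using that unfolding cut_edges_def by simp
  have finI: "finite I" unfolding I_def by simp
  \<comment> \<open>Members of \<open>I\<close> share only the neighbor \<open>x\<close>, so the cut
    edges behind different members are different.\<close>
  have disj: "(N y - closed_nbh x) \<inter> (N y' - closed_nbh x) = {}" if "y \<in> I" "y' \<in> I" "y \<noteq> y'" for y y'
  proof -
    have "x \<in> N y" "x \<in> N y'" using that neighbors_sym unfolding I_def by blast+
    then have "w = x" if "w \<in> N y" "w \<in> N y'" for w
      using common_neighbor_unique[OF \<open>y \<noteq> y'\<close>] that by blast
    then show ?thesis unfolding closed_nbh_def by blast
  qed
  have "sum c I = card (\<Union>y\<in>I. cut_edges (N y - closed_nbh x))"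
    unfolding c_def
  proof (rule card_UN_disjoint[symmetric, OF finI])
    show "\<forall>y\<in>I. finite (cut_edges (N y - closed_nbh x))" using finc by simp
    show "\<forall>y\<in>I. \<forall>y'\<in>I. y \<noteq> y' \<longrightarrow> cut_edges (N y - closed_nbh x) \<inter> cut_edges (N y' - closed_nbh x) = {}"
      using disj unfolding cut_edges_def by blast
  qed
  moreover have "card (\<Union>y\<in>I. cut_edges (N y - closed_nbh x)) + card (cut_edges (N x)) \<le> d"
  proof -
    have "card ((\<Union>y\<in>I. cut_edges (N y - closed_nbh x)) \<union> cut_edges (N x))
      = card (\<Union>y\<in>I. cut_edges (N y - closed_nbh x)) + card (cut_edges (N x))"
      by (rule card_Un_disjoint) (use finI finc in \<open>auto simp: cut_edges_def closed_nbh_def\<close>)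
    moreover have "card ((\<Union>y\<in>I. cut_edges (N y - closed_nbh x)) \<union> cut_edges (N x)) \<le> card (cut_edges X)"
      by (rule card_mono[OF finc[OF finX]]) (use x in \<open>auto simp: cut_edges_def I_def\<close>)
    ultimately show ?thesis using cut unfolding cut_edges_def by linarith
  qed
  moreover have "d \<le> card I + card (cut_edges (N x))"
  proof -
    have "N x - I \<subseteq> fst ` cut_edges (N x)"
    proof
      fix w assume w: "w \<in> N x - I"
      then obtain v where "v \<in> N w" "v \<notin> X" unfolding I_def by blast
      moreover have "v \<in> Y" using calculation neighbors_subset XY by blast
      ultimately have "(w, v) \<in> cut_edges (N x)" using w unfolding cut_edges_def by simp
      then show "w \<in> fst ` cut_edges (N x)" by force
    qed
    then have "card (N x - I) \<le> card (cut_edges (N x))" by (intro surj_card_le finc) auto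
    moreover have "card (N x - I) = d - card I"
      using card_neighbors x XY finI unfolding I_def by (subst card_Diff_subset) auto
    ultimately show ?thesis by linarith
  qed
  ultimately have "sum c I \<le> card I" by linarith
  then obtain T where T: "T \<subseteq> I" "card T = k" "sum c T \<le> k"
    using subset_with_small_sum[OF finI _ x(3)[folded I_def]] by blast
  have finT: "finite T" using finite_subset[OF T(1) finI] .
  have "(SIGMA u:(\<Union>y\<in>T. N y) - closed_nbh x. N u \<inter> Y) = (\<Union>y\<in>T. cut_edges (N y - closed_nbh x))"
    unfolding cut_edges_def by auto
  then have "card (SIGMA u:(\<Union>y\<in>T. N y) - closed_nbh x. N u \<inter> Y) \<le> k"
    using card_UN_le[OF finT, of "\<lambda>y. cut_edges (N y - closed_nbh x)"] T(3) unfolding c_def by simp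
  moreover have "T \<subseteq> N x" "\<And>y. y \<in> T \<Longrightarrow> N y \<subseteq> X" using T(1) unfolding I_def by auto
  ultimately show thesis using that x(1,2) T(2) by blast
qed

subsection \<open>Gluing the colorings of the two sides\<close>

lemma b_chromatic_number_if_cut:
  assumes XY: "X \<union> Y = V" "X \<inter> Y = {}" and "card X \<ge> 2" "card Y \<ge> 2"
    and cut: "card (SIGMA u:X. N u \<inter> Y) \<le> d" and d: "d > 0"
    and few_triangles: "\<And>u v. u \<in> N v \<Longrightarrow> card (N u \<inter> N v) + 3 \<le> d"
  shows "b_chromatic_number V E = d + 1"
proof -
  \<comment> \<open>The two stars have \<open>k + 1\<close> and \<open>k' + 1\<close> vertices,
    together \<open>d + 1\<close>, and both \<open>k\<close> and \<open>k'\<close> meet the bound of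
    the extension lemma.\<close>
  define k k' where "k = d div 2" and "k' = (d - 1) div 2"
  have kk: "k + k' + 1 = d" "2 * k \<le> d" "2 * k' \<le> d" using d unfolding k_def k'_def by linarith+
  have YX: "Y \<union> X = V" "Y \<inter> X = {}" using XY by auto
  have finXY: "finite X" "finite Y" using XY finite_vertices by (metis finite_Un)+
  have "(SIGMA u:Y. N u \<inter> X) \<subseteq> prod.swap ` (SIGMA u:X. N u \<inter> Y)"
  proof
    fix p assume "p \<in> (SIGMA u:Y. N u \<inter> X)"
    then obtain v u where "p = prod.swap (u, v)" "v \<in> Y" "u \<in> X" "u \<in> N v" by auto
    then show "p \<in> prod.swap ` (SIGMA u:X. N u \<inter> Y)"
      using neighbors_sym by (intro image_eqI[of _ _ "(u, v)"]) auto
  qed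
  moreover have "finite (SIGMA u:X. N u \<inter> Y)" using finXY by simp
  ultimately have cut': "card (SIGMA u:Y. N u \<inter> X) \<le> d" using cut by (meson le_trans surj_card_le)
  obtain x T where x: "x \<in> X" "N x \<subseteq> X" and T: "T \<subseteq> N x" "card T = k" "\<And>y. y \<in> T \<Longrightarrow> N y \<subseteq> X"
    and cT: "card (SIGMA u:(\<Union>y\<in>T. N y) - closed_nbh x. N u \<inter> Y) \<le> k"
    using interior_star[OF XY \<open>card X \<ge> 2\<close> cut d few_triangles kk(2)] by metis
  obtain x' T' where x': "x' \<in> Y" "N x' \<subseteq> Y" and T': "T' \<subseteq> N x'" "card T' = k'"
    "\<And>y. y \<in> T' \<Longrightarrow> N y \<subseteq> Y"
    and cT': "card (SIGMA u:(\<Union>y\<in>T'. N y) - closed_nbh x'. N u \<inter> X) \<le> k'"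
    using interior_star[OF YX \<open>card Y \<ge> 2\<close> cut' d few_triangles kk(3)] by metis
  have xV: "x \<in> V" "x' \<in> V" using x x' XY by auto
  have finT: "finite T" "finite T'" using T(1) T'(1) finite_neighbors finite_subset by blast+
  define A B C where "A = {..k}" and "B = {k<..d}" and "C = {..d}"
  have kd: "k \<le> d" using kk by simp
  have C: "finite C" "card C = d + 1" and fin: "finite A" "finite B" and AB: "A \<union> B = C" "A \<inter> B = {}"
    unfolding A_def B_def C_def using kd by auto
  have cA: "card A = k + 1" and cB: "card B = k' + 1" unfolding A_def B_def using kk by auto

  have cardT: "card (insert x T) = card A" "card (insert x' T') = card B"
    using T T' finT cA cB by (auto simp: card_insert_if)
  obtain g0 where g0: "bij_betw g0 (closed_nbh x) C" "g0 ` insert x T = A"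
    using bij_betw_with_image[of "closed_nbh x" C "insert x T" A] C card_closed_nbh[OF xV(1)] T(1) AB cardT
    unfolding closed_nbh_def by auto
  obtain g0' where g0': "bij_betw g0' (closed_nbh x') C" "g0' ` insert x' T' = B"
    using bij_betw_with_image[of "closed_nbh x'" C "insert x' T'" B] C card_closed_nbh[OF xV(2)] T'(1) AB cardT
    unfolding closed_nbh_def by auto
  define R where "R = closed_nbh x \<union> (\<Union>y\<in>T. N y)"
  define R' where "R' = closed_nbh x' \<union> (\<Union>y\<in>T'. N y)"
  have RX: "R \<subseteq> X" and RY: "R' \<subseteq> Y"
    using x T(3) x' T'(3) unfolding R_def R'_def closed_nbh_def by blast+
  obtain g where g: "\<And>v. v \<in> closed_nbh x \<Longrightarrow> g v = g0 v" "proper_on g R"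
    "\<And>y. y \<in> T \<Longrightarrow> bij_betw g (closed_nbh y) C"
    using closed_nbh_coloring_extends[OF xV(1) C g0(1) T(1)] T(2) kk(2) unfolding R_def by metis
  obtain g' where g': "\<And>v. v \<in> closed_nbh x' \<Longrightarrow> g' v = g0' v" "proper_on g' R'"
    "\<And>y. y \<in> T' \<Longrightarrow> bij_betw g' (closed_nbh y) C"
    using closed_nbh_coloring_extends[OF xV(2) C g0'(1) T'(1)] T'(2) kk(3) unfolding R'_def by metis
  have gx: "bij_betw g (closed_nbh y) C" if "y \<in> insert x T" for y
    using that g g0(1) bij_betw_cong[of "closed_nbh x" g g0] by auto
  have gx': "bij_betw g' (closed_nbh y) C" if "y \<in> insert x' T'" for y
    using that g' g0'(1) bij_betw_cong[of "closed_nbh x'" g' g0'] by auto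
  have R_cover: "R = (\<Union>y\<in>insert x T. closed_nbh y)" "R' = (\<Union>y\<in>insert x' T'. closed_nbh y)"
    using T(1) T'(1) unfolding R_def R'_def closed_nbh_def by auto
  have gC: "g ` R \<subseteq> C" "g' ` R' \<subseteq> C"
    using bij_betw_imp_surj_on[OF gx] bij_betw_imp_surj_on[OF gx'] unfolding R_cover image_UN
    by blast+
  have "g ` insert x T = g0 ` insert x T"
    by (rule image_cong) (use g(1) T(1) in \<open>auto simp: closed_nbh_def\<close>)
  then have gA: "g ` insert x T = A" using g0(2) by simp
  have "g' ` insert x' T' = g0' ` insert x' T'"
    by (rule image_cong) (use g'(1) T'(1) in \<open>auto simp: closed_nbh_def\<close>)
  then have gB: "g' ` insert x' T' = B" using g0'(2) by simp

  \<comment> \<open>The pair \<open>(g' v, g u)\<close> forbids a recoloring that sends the color of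
    \<open>v\<close> to that of \<open>u\<close>. Only cut edges starting outside
    \<open>closed_nbh x\<close> enter \<open>FA\<close>; \<open>cross\<close> shows that they are
    the only source of conflicts between colors in \<open>A\<close>.\<close>
  define FA where "FA = (\<lambda>(u, v). (g' v, g u)) ` (SIGMA u:(\<Union>y\<in>T. N y) - closed_nbh x. N u \<inter> Y)"
  define FB where "FB = (\<lambda>(v, u). (g' v, g u)) ` (SIGMA v:(\<Union>y\<in>T'. N y) - closed_nbh x'. N v \<inter> X)"
  have "finite FA" "finite FB" unfolding FA_def FB_def using finT by auto
  have "card FA \<le> k" unfolding FA_def
    by (rule order.trans[OF card_image_le cT]) (use finT in auto)
  then obtain sA where sA: "bij_betw sA A A" "\<And>a. a \<in> A \<Longrightarrow> (a, sA a) \<notin> FA"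
    using permutation_avoiding[OF fin(1) \<open>finite FA\<close>] cA by (metis Suc_eq_plus1 le_imp_less_Suc)
  have "card FB \<le> k'" unfolding FB_def
    by (rule order.trans[OF card_image_le cT']) (use finT in auto)
  then obtain sB where sB: "bij_betw sB B B" "\<And>a. a \<in> B \<Longrightarrow> (a, sB a) \<notin> FB"
    using permutation_avoiding[OF fin(2) \<open>finite FB\<close>] cB by (metis Suc_eq_plus1 le_imp_less_Suc)
  \<comment> \<open>\<open>s\<close> preserves both \<open>A\<close> and \<open>B\<close>, so a
    conflict after recoloring lies within a single block and the two shifts can be chosen
    independently.\<close>
  define s where "s a = (if a \<in> A then sA a else sB a)" for a
  have sbA: "bij_betw s A A"
    by (rule bij_betw_cong[THEN iffD1, OF _ sA(1)]) (simp add: s_def)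
  have sbB: "bij_betw s B B"
    by (rule bij_betw_cong[THEN iffD1, OF _ sB(1)]) (use AB in \<open>auto simp: s_def\<close>)
  have s: "bij_betw s C C" using bij_betw_combine[OF sbA sbB AB(2)] AB(1) by simp

  define h where "h v = (if v \<in> X then g v else s (g' v))" for v
  have hR: "h v = g v" if "v \<in> R" for v using that RX unfolding h_def by auto
  have hR': "h v = s (g' v)" if "v \<in> R'" for v using that RY XY unfolding h_def by auto
  \<comment> \<open>In \<open>closed_nbh x\<close> the colors of \<open>A\<close> occur only at
    \<open>x\<close> and on \<open>T\<close>, and these vertices have no neighbors in
    \<open>Y\<close>. A conflict in \<open>A\<close> thus starts outside \<open>closed_nbh x\<close>
    and is excluded by \<open>FA\<close>; likewise for \<open>B\<close>,
    \<open>closed_nbh x'\<close> and \<open>FB\<close>.\<close>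
  have cross: "g u \<noteq> s (g' v)" if uv: "u \<in> R" "v \<in> R'" "u \<in> N v" for u v
  proof
    assume eq: "g u = s (g' v)"
    have "g' v \<in> C" using gC uv by auto
    have vu: "v \<in> N u" using uv neighbors_sym by blast
    have u_out: "u \<notin> insert x T" using vu x T(3) RY uv(2) XY(2) by blast
    have v_out: "v \<notin> insert x' T'" using x' T'(3) RX uv XY(2) by blast
    consider "g' v \<in> A" | "g' v \<in> B" using \<open>g' v \<in> C\<close> AB by blast
    then show False
    proof cases
      case 1
      then have "g u \<in> A" using eq sbA unfolding bij_betw_def by auto
      have "u \<notin> closed_nbh x"
      proof
        assume u: "u \<in> closed_nbh x"
        obtain w where w: "w \<in> insert x T" "g w = g u" using gA \<open>g u \<in> A\<close> by (metis imageE)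
        then have "w \<in> closed_nbh x" using T(1) unfolding closed_nbh_def by auto
        then have "w = u" using gx[of x] w u unfolding bij_betw_def inj_on_def by auto
        then show False using w u_out by simp
      qed
      then have "(g' v, g u) \<in> FA" using uv vu RY unfolding FA_def R_def by force
      then show False using sA(2)[OF 1] eq 1 unfolding s_def by simp
    next
      case 2
      have "v \<notin> closed_nbh x'"
      proof
        assume v: "v \<in> closed_nbh x'"
        obtain w where w: "w \<in> insert x' T'" "g' w = g' v" using gB 2 by (metis imageE)
        then have "w \<in> closed_nbh x'" using T'(1) unfolding closed_nbh_def by auto
        then have "w = v" using gx'[of x'] w v unfolding bij_betw_def inj_on_def by auto
        then show False using w v_out by simp
      qed
      then have "(g' v, g u) \<in> FB" using uv RX unfolding FB_def R'_def by force
      moreover have "g' v \<notin> A" using 2 AB by auto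
      ultimately show False using sB(2)[OF 2] eq unfolding s_def by simp
    qed
  qed
  have proper: "proper_on h (R \<union> R')"
    unfolding proper_on_def
  proof (intro ballI impI)
    fix u v assume uv: "u \<in> R \<union> R'" "v \<in> R \<union> R'" "u \<in> N v"
    then have vu: "v \<in> N u" using neighbors_sym by blast
    consider "u \<in> R" "v \<in> R" | "u \<in> R" "v \<in> R'" | "u \<in> R'" "v \<in> R" | "u \<in> R'" "v \<in> R'" using uv by blast
    then show "h u \<noteq> h v"
    proof cases
      case 1
      then show ?thesis using g(2) uv(3) hR unfolding proper_on_def by simp
    next
      case 2
      then show ?thesis using cross uv(3) hR hR' by simp
    next
      case 3
      then show ?thesis using cross[of v u] vu hR hR' by simp
    next
      case 4
      then have "g' u \<noteq> g' v" "g' u \<in> C" "g' v \<in> C" using g'(2) uv(3) gC unfolding proper_on_def by auto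
      then show ?thesis using s 4 hR' unfolding bij_betw_def inj_on_def by auto
    qed
  qed
  have "s (g' v) \<in> C" if "v \<in> R'" for v
    using gC(2) that bij_betw_apply[OF s] by blast
  then have imC: "h ` (R \<union> R') \<subseteq> C"
    using gC(1) hR hR' by auto
  have dom: "\<exists>v\<in>R \<union> R'. closed_nbh v \<subseteq> R \<union> R' \<and> h v = c \<and> C \<subseteq> h ` closed_nbh v" if c: "c \<in> C" for c
  proof -
    consider "c \<in> A" | "c \<in> B" using c AB by blast
    then show ?thesis
    proof cases
      case 1
      then obtain v where v: "v \<in> insert x T" "g v = c" using gA by (metis imageE)
      then have sub: "closed_nbh v \<subseteq> R" using R_cover by blast
      then have "h ` closed_nbh v = g ` closed_nbh v" using hR by (intro image_cong) auto
      then have "h ` closed_nbh v = C" using gx[OF v(1)] unfolding bij_betw_def by simp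
      moreover have "v \<in> R" using sub unfolding closed_nbh_def by auto
      ultimately show ?thesis using sub v hR by (intro bexI[of _ v]) auto
    next
      case 2
      then obtain b where b: "b \<in> B" "c = s b" using sbB unfolding bij_betw_def by blast
      then obtain v where v: "v \<in> insert x' T'" "g' v = b" using gB by (metis imageE)
      then have sub: "closed_nbh v \<subseteq> R'" using R_cover by blast
      then have "h ` closed_nbh v = (\<lambda>u. s (g' u)) ` closed_nbh v" using hR' by (intro image_cong) auto
      also have "\<dots> = s ` (g' ` closed_nbh v)" by auto
      also have "\<dots> = C" using gx'[OF v(1)] s unfolding bij_betw_def by simp
      finally have "h ` closed_nbh v = C" .
      moreover have "v \<in> R'" using sub unfolding closed_nbh_def by auto
      ultimately show ?thesis using sub v b hR' by (intro bexI[of _ v]) auto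
    qed
  qed
  have "R \<union> R' \<subseteq> V" using RX RY XY by auto
  from b_chromatic_number_eqI[OF proper imC C this dom] show ?thesis .
qed

subsection \<open>Degree at most three\<close>

lemma neighbors_eqI:
  assumes "S \<subseteq> N v" "v \<in> V" "card S = d"
  shows "N v = S"
  using card_subset_eq[OF finite_neighbors assms(1)] card_neighbors assms by simp

text \<open>Such a \<open>K\<close> is a complete component, and any bijection onto the colors makes
  all its vertices dominating.\<close>

lemma b_chromatic_number_if_clique:
  assumes "K \<subseteq> V" "card K = d + 1" and K: "\<And>v. v \<in> K \<Longrightarrow> closed_nbh v = K"
  shows "b_chromatic_number V E = d + 1"
proof -
  have "finite K" using finite_subset[OF assms(1) finite_vertices] .
  then obtain g where g: "bij_betw g K {..d}"
    using finite_same_card_bij[of K "{..d}"] assms(2) by auto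
  have "proper_on g K"
    using g unfolding proper_on_def bij_betw_def inj_on_def by auto
  moreover have "\<exists>v\<in>K. closed_nbh v \<subseteq> K \<and> g v = c \<and> {..d} \<subseteq> g ` closed_nbh v" if c: "c \<in> {..d}" for c
  proof -
    obtain v where v: "v \<in> K" "g v = c" using g c unfolding bij_betw_def by (metis imageE)
    have "g ` closed_nbh v = {..d}" using g K[OF v(1)] by (simp add: bij_betw_def)
    then show ?thesis using v K[OF v(1)] by (intro bexI[of _ v]) simp_all
  qed
  ultimately show ?thesis
    using g assms(1) by (intro b_chromatic_number_eqI[of g K "{..d}"]) (auto simp: bij_betw_def)
qed

text \<open>The closed neighborhood of any vertex is a component consisting of one vertex or one
  edge, hence a clique.\<close>

lemma b_chromatic_number_degree_le_1:
  assumes "d \<le> 1"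
  shows "b_chromatic_number V E = d + 1"
proof -
  obtain x where x: "x \<in> V" using vertices_nonempty by blast
  show ?thesis
  proof (rule b_chromatic_number_if_clique[OF closed_nbh_subset[OF x] card_closed_nbh[OF x]])
    fix v assume v: "v \<in> closed_nbh x"
    have "N v = {x}" if "v \<in> N x"
    proof (rule neighbors_eqI)
      have "d > 0" using card_neighbors[OF x] that by (auto simp: card_gt_0_iff)
      then show "card {x} = d" using assms by simp
    qed (use that neighbors_sym neighbor_in_V in blast)+
    moreover have "N x = {v}" if "v \<in> N x"
    proof (rule neighbors_eqI)
      have "d > 0" using card_neighbors[OF x] that by (auto simp: card_gt_0_iff)
      then show "card {v} = d" using assms by simp
    qed (use that x in auto)
    ultimately show "closed_nbh v = closed_nbh x"
      using v unfolding closed_nbh_def by auto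
  qed
qed

text \<open>A triangle is a complete component. Otherwise \<open>a'\<close>, \<open>a\<close>,
  \<open>x\<close>, \<open>b\<close>, \<open>b'\<close> is a path on five distinct vertices, since
  \<open>a' = b'\<close> would close a 4-cycle; colored 2, 1, 0, 2, 1, its three middle vertices see
  all colors. The ends have different colors and may be adjacent.\<close>

lemma b_chromatic_number_degree_2:
  assumes d: "d = 2"
  shows "b_chromatic_number V E = d + 1"
proof -
  obtain x where x: "x \<in> V" using vertices_nonempty by blast
  then obtain a b where Nx: "N x = {a, b}" "a \<noteq> b"
    using card_neighbors[OF x] d by (auto simp: card_2_iff)
  have in_V: "a \<in> V" "b \<in> V" using Nx neighbor_in_V by blast+
  have ax: "x \<in> N a" "x \<in> N b" using Nx neighbors_sym by blast+
  have ne: "a \<noteq> x" "b \<noteq> x" using ax by auto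
  show ?thesis
  proof (cases "a \<in> N b")
    case True
    then have "b \<in> N a" using neighbors_sym by blast
    have "N a = {x, b}" by (rule neighbors_eqI) (use ax ne \<open>b \<in> N a\<close> in_V d in auto)
    moreover have "N b = {x, a}" by (rule neighbors_eqI) (use ax ne True in_V d in auto)
    ultimately show ?thesis
      using b_chromatic_number_if_clique[of "{x, a, b}"] x in_V ne Nx d
      unfolding closed_nbh_def by auto
  next
    case False
    then have ba: "b \<notin> N a" using neighbors_sym by blast
    have other: "\<exists>z. N v = {x, z} \<and> z \<noteq> x" if v: "v \<in> V" "x \<in> N v" for v
    proof -
      have "card (N v) = 2" using card_neighbors[OF v(1)] d by simp
      then show ?thesis using v(2) by (auto simp: card_2_iff)
    qed
    obtain a' where a': "N a = {x, a'}" "a' \<noteq> x" using other[OF in_V(1) ax(1)] by blast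
    obtain b' where b': "N b = {x, b'}" "b' \<noteq> x" using other[OF in_V(2) ax(2)] by blast
    have "a' \<noteq> b'" using common_neighbor_unique[OF Nx(2), of x a'] a' b' by auto
    have distinct: "a' \<noteq> a" "a' \<noteq> b" "b' \<noteq> a" "b' \<noteq> b"
      using a' b' ba False neighbors_irrefl[of a] neighbors_irrefl[of b] by auto
    define g :: "'a \<Rightarrow> nat" where "g v = (if v = x then 0 else if v = a \<or> v = b' then 1 else 2)" for v
    let ?R = "{x, a, b, a', b'}"
    have gv: "g x = 0" "g a = 1" "g b = 2" "g a' = 2" "g b' = 1"
      using ne Nx a' b' distinct \<open>a' \<noteq> b'\<close> unfolding g_def by auto
    have nonadj: "b' \<notin> N a" "a' \<notin> N b" "a \<notin> N b'" "b \<notin> N a'"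
      using a' b' distinct \<open>a' \<noteq> b'\<close> neighbors_sym by blast+
    have "proper_on g ?R"
      unfolding proper_on_def using gv nonadj by auto
    moreover have "?R \<subseteq> V" using x in_V a' b' neighbor_in_V by blast
    moreover have "\<exists>v\<in>?R. closed_nbh v \<subseteq> ?R \<and> g v = c \<and> {..2} \<subseteq> g ` closed_nbh v" if c: "c \<in> {..2}" for c
    proof -
      have C: "{..2} = {0, 1, 2 :: nat}" by auto
      consider "c = 0" | "c = 1" | "c = 2" using c by force
      then show ?thesis
      proof cases
        case 1
        then show ?thesis using Nx gv unfolding C closed_nbh_def by (intro bexI[of _ x]) auto
      next
        case 2
        then show ?thesis using a' gv unfolding C closed_nbh_def by (intro bexI[of _ a]) auto
      next
        case 3
        then show ?thesis using b' gv unfolding C closed_nbh_def by (intro bexI[of _ b]) auto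
      qed
    qed
    ultimately show ?thesis
      using gv d by (intro b_chromatic_number_eqI[of g ?R "{..2}"]) auto
  qed
qed

text \<open>By the absence of 4-cycles the third neighbors \<open>a'\<close>, \<open>b'\<close>,
  \<open>c'\<close> of the triangle are distinct and pairwise nonadjacent, so all of them can have
  color 3, and then \<open>a\<close>, \<open>b\<close>, \<open>c\<close> see all colors. For color 3
  itself, \<open>a'\<close> dominates once its other neighbors \<open>p\<close> and \<open>q\<close>
  get colors 1 and 2.\<close>

lemma b_chromatic_number_cubic_triangle:
  assumes d: "d = 3" and tri: "a \<in> N b" "c \<in> N a" "c \<in> N b"
  shows "b_chromatic_number V E = d + 1"
proof -
  have tri': "b \<in> N a" "a \<in> N c" "b \<in> N c" using tri neighbors_sym by blast+
  have in_V: "a \<in> V" "b \<in> V" "c \<in> V" using tri neighbor_in_V by blast+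
  have abc: "a \<noteq> b" "a \<noteq> c" "b \<noteq> c" using tri by auto
  have third: "\<exists>z. N v = {s, t, z} \<and> z \<noteq> s \<and> z \<noteq> t" if v: "v \<in> V" "s \<in> N v" "t \<in> N v" "s \<noteq> t" for v s t
  proof -
    have "card (N v - {s, t}) = 1"
      using card_neighbors[OF v(1)] v d by (subst card_Diff_subset) auto
    then obtain z where "N v - {s, t} = {z}" by (auto simp: card_1_singleton_iff)
    then show ?thesis using v by blast
  qed
  obtain a' where a': "N a = {b, c, a'}" "a' \<noteq> b" "a' \<noteq> c"
    using third[OF in_V(1), of b c] tri tri' abc by auto
  obtain b' where b': "N b = {a, c, b'}" "b' \<noteq> a" "b' \<noteq> c"
    using third[OF in_V(2), of a c] tri tri' abc by auto
  obtain c' where c': "N c = {a, b, c'}" "c' \<noteq> a" "c' \<noteq> b"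
    using third[OF in_V(3), of a b] tri tri' abc by auto
  have own: "a' \<noteq> a" "b' \<noteq> b" "c' \<noteq> c"
    using a' b' c' neighbors_irrefl by blast+
  have distinct: "a' \<noteq> b'" "a' \<noteq> c'" "b' \<noteq> c'"
    using common_neighbor_unique[of a b c a'] common_neighbor_unique[of a c b a']
      common_neighbor_unique[of b c a b'] a' b' c' abc by auto
  have outer: "a \<in> N a'" "b \<in> N b'" "c \<in> N c'" using a' b' c' neighbors_sym by blast+
  have indep: "a' \<notin> N b'" "a' \<notin> N c'" "b' \<notin> N c'"
    using common_neighbor_unique[of a b' b a'] common_neighbor_unique[of a c' c a']
      common_neighbor_unique[of b c' c b'] a' b' c' outer by auto
  then have indep': "b' \<notin> N a'" "c' \<notin> N a'" "c' \<notin> N b'" using neighbors_sym by blast+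
  have a'V: "a' \<in> V" using a' neighbor_in_V by blast
  have "card (N a' - {a}) = 2" using card_neighbors[OF a'V] d outer by simp
  then obtain p q where "N a' - {a} = {p, q}" and pq: "p \<noteq> q" by (auto simp: card_2_iff)
  then have Na': "N a' = {a, p, q}" and pqa: "p \<noteq> a" "q \<noteq> a" using outer by auto
  have "a' \<notin> N b" "a' \<notin> N c" using a' b' c' own distinct by auto
  then have b_far: "b \<notin> N a'" "c \<notin> N a'" using neighbors_sym by blast+
  have pq_ne: "p \<notin> {b, c, a', b', c'}" "q \<notin> {b, c, a', b', c'}"
    using Na' b_far indep' neighbors_irrefl[of a'] by auto
  \<comment> \<open>Besides the three vertices of color 3, the only equally colored pairs will be
    \<open>b\<close>, \<open>p\<close> and \<open>c\<close>, \<open>q\<close>.\<close>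
  have pq_far: "p \<notin> N b" "q \<notin> N c" "b \<notin> N p" "c \<notin> N q"
  proof -
    show 1: "p \<notin> N b" "q \<notin> N c" using b' c' pq_ne pqa by auto
    show "b \<notin> N p" "c \<notin> N q" using 1 neighbors_sym by blast+
  qed
  define g :: "'a \<Rightarrow> nat" where
    "g v = (if v = a then 0 else if v = b \<or> v = p then 1 else if v = c \<or> v = q then 2 else 3)" for v
  let ?R = "{a, b, c, a', b', c', p, q}"
  have gv: "g a = 0" "g b = 1" "g c = 2" "g a' = 3" "g b' = 3" "g c' = 3" "g p = 1" "g q = 2"
    using abc own a' b' c' pq pq_ne pqa unfolding g_def by auto
  have "proper_on g ?R"
    unfolding proper_on_def using gv indep indep' pq_far by auto
  moreover have "?R \<subseteq> V"
    using in_V a'V neighbors_subset[of b] neighbors_subset[of c] neighbors_subset[of a'] b' c' Na' by simp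
  moreover have "\<exists>v\<in>?R. closed_nbh v \<subseteq> ?R \<and> g v = i \<and> {..3} \<subseteq> g ` closed_nbh v" if i: "i \<in> {..3}" for i
  proof -
    have C: "{..3} = {0, 1, 2, 3 :: nat}" by auto
    consider "i = 0" | "i = 1" | "i = 2" | "i = 3" using i by force
    then show ?thesis
    proof cases
      case 1
      then show ?thesis using a' gv unfolding C closed_nbh_def by (intro bexI[of _ a]) auto
    next
      case 2
      then show ?thesis using b' gv unfolding C closed_nbh_def by (intro bexI[of _ b]) auto
    next
      case 3
      then show ?thesis using c' gv unfolding C closed_nbh_def by (intro bexI[of _ c]) auto
    next
      case 4
      then show ?thesis using Na' gv unfolding C closed_nbh_def by (intro bexI[of _ a']) auto
    qed
  qed
  ultimately show ?thesis
    using gv d by (intro b_chromatic_number_eqI[of g ?R "{..3}"]) auto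
qed

end

section \<open>Case distinction by degree and triangles\<close>

theorem theorem1:
  fixes V :: "'a set" and E :: "'a set set" and d :: nat
  assumes "simple_graph V E"
    and "regular V E d"
    and "\<not> contains_C4 E"
    and "\<not> super_edge_connected V E d"
  shows "b_chromatic_number V E = d + 1"
proof -
  interpret C4_free_regular_graph V E d
    using assms by (simp add: C4_free_regular_graph_def C4_free_regular_graph_axioms_def)
  \<comment> \<open>The bound in \<open>few_triangles\<close> treats two cases alike: for
    \<open>d \<ge> 4\<close> it holds because distinct vertices have at most one common neighbor,
    and for \<open>d = 3\<close> it says that there is no triangle.\<close>
  consider "d \<le> 1" | "d = 2" | (triangle) a b c where "d = 3" "a \<in> N b" "c \<in> N a" "c \<in> N b"
    | (few_triangles) "d \<ge> 3" "\<And>u v. u \<in> N v \<Longrightarrow> card (N u \<inter> N v) + 3 \<le> d"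
  proof (cases "d \<ge> 4")
    case True
    have "card (N u \<inter> N v) + 3 \<le> d" if "u \<in> N v" for u v
    proof -
      have "u \<noteq> v" using that by auto
      from card_common_neighbors_le[OF this] True show ?thesis by linarith
    qed
    then show thesis using that(4) True by simp
  next
    case False
    show thesis
    proof (cases "\<exists>a b c. a \<in> N b \<and> c \<in> N a \<and> c \<in> N b")
      case True
      then show thesis using that(1-3) False by fastforce
    next
      case no_triangle: False
      have "card (N u \<inter> N v) = 0" if "u \<in> N v" for u v
      proof -
        have "N u \<inter> N v = {}" using no_triangle that by blast
        then show ?thesis by simp
      qed
      then show thesis using that(1,2,4) False by fastforce
    qed
  qed
  then show ?thesis
  proof cases
    case 1
    then show ?thesis by (rule b_chromatic_number_degree_le_1)
  next
    case 2
    then show ?thesis by (rule b_chromatic_number_degree_2)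
  next
    case triangle
    then show ?thesis by (rule b_chromatic_number_cubic_triangle)
  next
    case few_triangles
    then have d: "d > 0" by simp
    obtain X Y where "X \<union> Y = V" "X \<inter> Y = {}" "card X \<ge> 2" "card Y \<ge> 2"
      "card (SIGMA u:X. N u \<inter> Y) \<le> d"
      using small_cut_if_not_super_edge_connected[OF d assms(4)] .
    then show ?thesis using b_chromatic_number_if_cut d few_triangles(2) by blast
  qed
qed

end
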